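(* Let $Y$ be a random variable and let $Y^1, Y^2, \dots, Y^m$ be independent copies of $Y$. Then $$\mathbb{P}\left[Y \geq 2\,\mathbb{E}\left[\max\left\{0, Y^1, \dots, Y^m\right\}\right]\right] \leq \frac{\ln(2)}{m}.$$
   Context: Here $Y$ is real-valued and $m$ is a positive integer. "Independent copies of $Y$" means mutually independent random variables, each with the same distribution as $Y$; superscripts are indices, not powers. $\ln$ denotes the natural logarithm.
   Formalization: The formal statement adds the hypothesis that P[Y > 0] > 0 or P[Y = 0] = 0; without it the claim fails, e.g. for Y = 0 almost surely, where the left side is 1 > ln(2)/m. *)

theory Defs
  imports "HOL-Probability.Probability"
begin

text \<open>
  The expectation of the nonnegative variable \<open>max {0, Z 1, \<dots>, Z m}\<close> always exists in
  \<open>[0, \<infinity>]\<close>, so it is taken as an extended real.  The Bochner integral would be \<open>0\<close>, not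
  \<open>\<infinity>\<close>, when the maximum is not integrable.
\<close>

definition expected_max0 :: "'a measure \<Rightarrow> nat \<Rightarrow> (nat \<Rightarrow> 'a \<Rightarrow> real) \<Rightarrow> ereal" where
  "expected_max0 M m Z =
     enn2ereal (\<integral>\<^sup>+ \<omega>. ennreal (Max (insert 0 ((\<lambda>i. Z i \<omega>) ` {1..m}))) \<partial>M)"

definition independent_copies ::
  "'a measure \<Rightarrow> ('a \<Rightarrow> real) \<Rightarrow> nat \<Rightarrow> (nat \<Rightarrow> 'a \<Rightarrow> real) \<Rightarrow> bool" where
  "independent_copies M Y m Z \<longleftrightarrow>
     prob_space.indep_vars M (\<lambda>_. borel) Z {1..m} \<and>
     (\<forall>i\<in>{1..m}. distr M borel (Z i) = distr M borel Y)"

end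

theory Submission imports Defs
begin

text \<open>
  Put \<open>t = 2 * expected_max0 M m Z\<close> and let \<open>p\<close> be the probability of \<open>Y \<ge> t\<close>.
  For \<open>0 < t < \<infinity>\<close>, the maximum reaches \<open>t\<close> with probability \<open>1 - (1 - p) ^ m\<close>, and with
  probability at most \<open>1/2\<close> by Markov's inequality.  Hence
  \<open>1/2 \<le> (1 - p) ^ m \<le> exp (- p * m)\<close>.  For \<open>t = 0\<close>, almost surely \<open>Y \<le> 0\<close>, and \<open>Y = 0\<close> has
  probability \<open>0\<close> by the last hypothesis; for \<open>t = \<infinity>\<close> the event is empty.
\<close>

text \<open>Taking logarithms in \<open>1 / 2 \<le> exp (- (real m * p))\<close> makes the bound
  linear in \<open>p\<close>; the constant is \<open>ln 2 = - ln (1 / 2)\<close>.\<close>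

lemma le_ln2_div_if_half_le_power:
  fixes p :: real and m :: nat
  assumes "m \<ge> 1" "p \<le> 1" "1 / 2 \<le> (1 - p) ^ m"
  shows "p \<le> ln 2 / real m"
proof -
  have "1 - p \<le> exp (- p)"
    using exp_ge_add_one_self[of "- p"] by simp
  \<comment> \<open>By \<open>p \<le> 1\<close> the base \<open>1 - p\<close> is nonnegative, so
    powers preserve the inequality.\<close>
  then have "(1 - p) ^ m \<le> exp (- p) ^ m"
    using assms(2) by (intro power_mono) auto
  also have "\<dots> = exp (- (real m * p))"
    by (simp flip: exp_of_nat_mult)
  finally have "1 / 2 \<le> exp (- (real m * p))"
    using assms(3) by linarith
  then have "real m * p \<le> ln 2"
    using ln_mono[of "1 / 2" "exp (- (real m * p))"]
    by (simp add: ln_div)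
  then show ?thesis
    using assms(1) by (simp add: field_simps)
qed

lemma prob_eq_of_distr_eq:
  assumes "distr M N X = distr M N Y" "X \<in> measurable M N" "Y \<in> measurable M N" "A \<in> sets N"
  shows "\<P>(\<omega> in M. X \<omega> \<in> A) = \<P>(\<omega> in M. Y \<omega> \<in> A)"
  using assms measure_distr[OF assms(2,4)] measure_distr[OF assms(3,4)]
  by (simp add: vimage_def Int_def conj_commute)

context
  fixes M :: "'a measure" and Y :: "'a \<Rightarrow> real" and Z :: "nat \<Rightarrow> 'a \<Rightarrow> real" and m :: nat
  assumes prob_space: "prob_space M"
    and Y_measurable [measurable]: "Y \<in> borel_measurable M"
    and m_pos: "m \<ge> 1"
    and copies: "independent_copies M Y m Z"
begin

interpretation prob_space M by (fact prob_space)

lemma copy_measurable: "i \<in> {1..m} \<Longrightarrow> Z i \<in> borel_measurable M"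
  using copies by (auto simp: independent_copies_def indep_vars_def2)

lemma prob_copy_eq:
  assumes "i \<in> {1..m}" "A \<in> sets borel"
  shows "\<P>(\<omega> in M. Z i \<omega> \<in> A) = \<P>(\<omega> in M. Y \<omega> \<in> A)"
  using prob_eq_of_distr_eq[of M borel "Z i" Y A] copies assms copy_measurable
  by (auto simp: independent_copies_def)

text \<open>Independence factors the joint event, and equality of laws makes all factors equal. The
  inequality is strict so that the complement says that some copy is at least
  \<open>t\<close>.\<close>

lemma prob_all_copies_less: "\<P>(\<omega> in M. \<forall>i\<in>{1..m}. Z i \<omega> < t) = (1 - \<P>(\<omega> in M. Y \<omega> \<ge> t)) ^ m"
proof -
  have "indep_vars (\<lambda>_. borel) Z {1..m}"
    using copies by (simp add: independent_copies_def)
  then have "prob (\<Inter>i\<in>{1..m}. Z i -` {..<t} \<inter> space M) = (\<Prod>i\<in>{1..m}. prob (Z i -` {..<t} \<inter> space M))"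
    using m_pos by (intro indep_varsD) auto
  \<comment> \<open>Here \<open>m_pos\<close> matters: an empty intersection would be
    \<open>UNIV\<close> instead of \<open>space M\<close>.\<close>
  also have "(\<Inter>i\<in>{1..m}. Z i -` {..<t} \<inter> space M) = {\<omega> \<in> space M. \<forall>i\<in>{1..m}. Z i \<omega> < t}"
    using m_pos by auto
  also have "(\<Prod>i\<in>{1..m}. prob (Z i -` {..<t} \<inter> space M)) = (\<Prod>i\<in>{1..m}. \<P>(\<omega> in M. Y \<omega> < t))"
    using prob_copy_eq[of _ "{..<t}"]
    by (intro prod.cong) (auto simp: vimage_def Int_def conj_commute)
  also have "\<P>(\<omega> in M. Y \<omega> < t) = 1 - \<P>(\<omega> in M. Y \<omega> \<ge> t)"
    by (subst prob_neg[symmetric]) (auto simp: not_le)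
  finally show ?thesis by simp
qed

text \<open>On the event that some copy reaches \<open>t\<close>, the maximum is at least
  \<open>t\<close>. Integrating \<open>t\<close> times the indicator of this event gives the bound,
  and \<open>prob_all_copies_less\<close> gives the probability of its complement.\<close>

lemma markov_max0:
  assumes "t > 0"
  shows "ereal (t * (1 - (1 - \<P>(\<omega> in M. Y \<omega> \<ge> t)) ^ m)) \<le> expected_max0 M m Z"
proof -
  define A where "A = {\<omega> \<in> space M. \<not> (\<forall>i\<in>{1..m}. Z i \<omega> < t)}"
  have less_sets: "{\<omega> \<in> space M. \<forall>i\<in>{1..m}. Z i \<omega> < t} \<in> events"
    using copy_measurable by (intro sets.sets_Collect_finite_All) auto
  then have A: "A \<in> events"
    unfolding A_def by (rule sets.sets_Collect_neg)
  have prob_A: "prob A = 1 - (1 - \<P>(\<omega> in M. Y \<omega> \<ge> t)) ^ m"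
    using prob_neg[OF less_sets] by (simp only: A_def prob_all_copies_less)
  have "ennreal (t * prob A) = (\<integral>\<^sup>+ \<omega>. ennreal t * indicator A \<omega> \<partial>M)"
    using A assms by (simp add: nn_integral_cmult_indicator emeasure_eq_measure ennreal_mult)
  also have "\<dots> \<le> (\<integral>\<^sup>+ \<omega>. ennreal (Max (insert 0 ((\<lambda>i. Z i \<omega>) ` {1..m}))) \<partial>M)"
  proof (rule nn_integral_mono)
    fix \<omega>
    show "ennreal t * indicator A \<omega> \<le> ennreal (Max (insert 0 ((\<lambda>i. Z i \<omega>) ` {1..m})))"
    proof (cases "\<omega> \<in> A")
      case True
      then obtain i where "i \<in> {1..m}" "t \<le> Z i \<omega>"
        by (auto simp: A_def not_less)
      then have "t \<le> Max (insert 0 ((\<lambda>i. Z i \<omega>) ` {1..m}))"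
        by (subst Max_ge_iff) auto
      then show ?thesis
        using True by (simp add: ennreal_leI)
    qed simp
  qed
  finally show ?thesis
    using assms by (simp add: expected_max0_def prob_A[symmetric] less_eq_ennreal.rep_eq)
qed

text \<open>The maximum dominates the positive part of a single copy, which therefore vanishes
  almost surely; equality of laws carries this over to \<open>Y\<close>.\<close>

lemma AE_nonpos_if_expected_max0_eq_0:
  assumes "expected_max0 M m Z = 0"
  shows "AE \<omega> in M. Y \<omega> \<le> 0"
proof -
  have Z1 [measurable]: "Z 1 \<in> borel_measurable M"
    using copy_measurable m_pos by simp
  \<comment> \<open>Since \<open>ennreal\<close> sends negative values to 0, the left side
    integrates the positive part of \<open>Z 1\<close>.\<close>
  have "(\<integral>\<^sup>+ \<omega>. ennreal (Z 1 \<omega>) \<partial>M) \<le> (\<integral>\<^sup>+ \<omega>. ennreal (Max (insert 0 ((\<lambda>i. Z i \<omega>) ` {1..m}))) \<partial>M)"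
    using m_pos by (intro nn_integral_mono ennreal_leI Max_ge) auto
  also have "\<dots> = 0"
    using assms by (simp add: expected_max0_def flip: zero_ennreal.rep_eq add: enn2ereal_inject)
  finally have "AE \<omega> in M. Z 1 \<omega> \<le> 0"
    by (simp add: nn_integral_0_iff_AE ennreal_eq_0_iff del: One_nat_def)
  then have "\<P>(\<omega> in M. Z 1 \<omega> \<in> {..0}) = 1"
    by (simp add: prob_Collect_eq_1 del: One_nat_def)
  then have "\<P>(\<omega> in M. Y \<omega> \<in> {..0}) = 1"
    using prob_copy_eq[of 1 "{..0}"] m_pos by simp
  then show ?thesis
    by (simp add: prob_Collect_eq_1)
qed

end

theorem lemma1p2:
  fixes M :: "'a measure" and Y :: "'a \<Rightarrow> real" and Z :: "nat \<Rightarrow> 'a \<Rightarrow> real" and m :: nat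
  assumes "prob_space M"
    and "Y \<in> borel_measurable M"
    and "m \<ge> 1"
    and "independent_copies M Y m Z"
    and "\<P>(\<omega> in M. Y \<omega> > 0) > 0 \<or> \<P>(\<omega> in M. Y \<omega> = 0) = 0"
  shows "\<P>(\<omega> in M. ereal (Y \<omega>) \<ge> 2 * expected_max0 M m Z) \<le> ln 2 / real m"
proof -
  interpret prob_space M by fact
  note [measurable] = assms(2)
  have "expected_max0 M m Z \<ge> 0"
    by (simp add: expected_max0_def)
  then consider "expected_max0 M m Z = \<infinity>" | "expected_max0 M m Z = 0"
    | e where "expected_max0 M m Z = ereal e" "e > 0"
    by (cases "expected_max0 M m Z") (auto simp: less_le)
  then show ?thesis
  proof cases
    case 1
    then show ?thesis by simp
  next
    case 2
    then have nonpos: "AE \<omega> in M. Y \<omega> \<le> 0"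
      using AE_nonpos_if_expected_max0_eq_0 assms by blast
    then have "\<P>(\<omega> in M. Y \<omega> > 0) = 0"
      by (subst prob_Collect_eq_0) (auto simp: not_less)
    \<comment> \<open>The first alternative of the hypothesis is now excluded, so the second holds.
      It rules out cases such as \<open>Y = 0\<close>, where the event has probability 1, which
      exceeds \<open>ln 2 / real m\<close>.\<close>
    with assms(5) have "\<P>(\<omega> in M. Y \<omega> = 0) = 0"
      by linarith
    then have "AE \<omega> in M. Y \<omega> \<noteq> 0"
      by (simp add: prob_Collect_eq_0)
    with nonpos have "AE \<omega> in M. \<not> 0 \<le> Y \<omega>"
      by eventually_elim simp
    then have "\<P>(\<omega> in M. 0 \<le> Y \<omega>) = 0"
      by (subst prob_Collect_eq_0) auto
    with 2 show ?thesis by simp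
  next
    case 3
    define p where "p = \<P>(\<omega> in M. Y \<omega> \<ge> 2 * e)"
    \<comment> \<open>The threshold is twice the expectation, so dividing by
      \<open>2 * e > 0\<close> leaves exactly \<open>1 / 2\<close>.\<close>
    have "2 * e * (1 - (1 - p) ^ m) \<le> e"
      using markov_max0[OF assms(1-4), of "2 * e"] 3 by (simp add: p_def)
    then have "1 / 2 \<le> (1 - p) ^ m"
      using 3(2) by (simp add: field_simps)
    then have "p \<le> ln 2 / real m"
      using assms(3) by (intro le_ln2_div_if_half_le_power) (auto simp: p_def)
    with 3(1) show ?thesis
      by (simp add: p_def)
  qed
qed

end
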